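(* Suppose $d,k,n$ are positive integers with $k\ge 2$ and $n\ge 3$. Let \[\delta=\min\left(d,\left\lfloor\frac n2\right\rfloor\right)\quad\text{and}\quad m=\left\lfloor\frac{(k-1)n}{\delta+1}\right\rfloor .\] Then \[\chi^k_d(C_n)=\begin{cases}1&\text{if }1\le d\le k-2,\\[0.3em] \left\lceil\dfrac nm\right\rceil&\text{if }d\ge k-1.\end{cases}\]
   Context: $C_n$ is the cycle graph on $n$ vertices. A shortest path in a graph $G$ is a path between some vertices $u,v$ whose length (number of edges) equals the graph distance between $u$ and $v$. A set $S\subseteq V(G)$ is $k,d$-independent in $G$ if every shortest path in $G$ of length at most $d$ contains fewer than $k$ vertices of $S$. A coloring $f:V(G)\to\{1,\dots,c\}$ is a $k,d$-proper $c$-coloring if every color class is $k,d$-independent. The $k,d$-chromatic number $\chi^k_d(G)$ is the least positive integer $c$ for which $G$ admits a $k,d$-proper $c$-coloring. *)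

theory Defs
  imports Complex_Main "HOL-Library.FuncSet" "Graph_Theory.Graph_Theory"
begin

text \<open>
  Undirected graphs are the symmetric digraphs of locale \<^locale>\<open>graph\<close>: finite, without loops or
  parallel arcs, every edge being a pair of opposite arcs. An arc path traverses as many arcs as
  the undirected path has edges.
\<close>

context graph
begin

definition graph_dist :: "'a \<Rightarrow> 'a \<Rightarrow> ereal" where
  "graph_dist u v = \<mu> (\<lambda>_. 1) u v"

definition shortest_path :: "'a \<Rightarrow> 'b awalk \<Rightarrow> 'a \<Rightarrow> bool" where
  "shortest_path u p v \<longleftrightarrow> apath u p v \<and> ereal (real (length p)) = graph_dist u v"

definition kd_independent :: "nat \<Rightarrow> nat \<Rightarrow> 'a set \<Rightarrow> bool" where
  "kd_independent k d S \<longleftrightarrow> S \<subseteq> verts G \<and>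
    (\<forall>u p v. shortest_path u p v \<and> length p \<le> d \<longrightarrow> card (S \<inter> set (awalk_verts u p)) < k)"

definition kd_proper_coloring :: "nat \<Rightarrow> nat \<Rightarrow> nat \<Rightarrow> ('a \<Rightarrow> nat) \<Rightarrow> bool" where
  "kd_proper_coloring k d c f \<longleftrightarrow> f \<in> verts G \<rightarrow> {1..c} \<and>
    (\<forall>i\<in>{1..c}. kd_independent k d {v \<in> verts G. f v = i})"

text \<open>
  For \<open>k \<ge> 2\<close> an injective coloring is proper, so the least element exists;
  for \<open>k \<le> 1\<close> and a nonempty graph there is no proper coloring and the value is unspecified.
\<close>

definition kd_chromatic_number :: "nat \<Rightarrow> nat \<Rightarrow> nat" where
  "kd_chromatic_number k d = (LEAST c. c > 0 \<and> (\<exists>f. kd_proper_coloring k d c f))"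

end

definition cycle_graph :: "nat \<Rightarrow> nat pair_pre_digraph" where
  "cycle_graph n = \<lparr> pverts = {0..<n},
     parcs = {(i, j). i < n \<and> j < n \<and> (j = Suc i mod n \<or> i = Suc j mod n)} \<rparr>"

text \<open>For \<open>n < 3\<close> the definition above does not describe a cycle.\<close>

lemma graph_cycle_graph:
  assumes "n \<ge> 3"
  shows "graph (with_proj (cycle_graph n))"
proof -
  have fin: "finite (parcs (cycle_graph n))"
    by (rule finite_subset[of _ "{0..<n} \<times> {0..<n}"]) (auto simp: cycle_graph_def)
  have neq: False if "i < n" "i = Suc i mod n" for i
    using that assms by (cases "Suc i = n") auto
  have "pair_graph (cycle_graph n)"
    using fin
    by unfold_locales (auto simp: cycle_graph_def symmetric_def sym_def dest: neq neq[OF _ sym])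
  then interpret pair_graph "cycle_graph n" .
  show ?thesis by unfold_locales
qed

end

theory Submission
  imports Defs
begin

text \<open>
  Shortest paths of length at most \<open>d\<close> in the cycle are arcs of at most \<open>\<delta> + 1\<close> consecutive
  vertices, so a color class is independent iff each of the \<open>n\<close> cyclic windows of \<open>\<delta> + 1\<close>
  vertices meets it in at most \<open>k - 1\<close> points. Double counting bounds a class by \<open>m\<close>. Conversely,
  \<open>v \<mapsto> (v m mod n) div m\<close> uses \<open>\<lceil>n / m\<rceil>\<close> colors: if \<open>v < w\<close> have the same color and \<open>v m\<close>,
  \<open>w m\<close> lie in blocks \<open>s\<close>, \<open>t\<close> of length \<open>n\<close>, then \<open>s < t\<close> and \<open>(w - v) m > (t - s) n - m\<close>.
  Hence \<open>k\<close> points of one color spread over more than \<open>(k - 1) n / m - 1 \<ge> \<delta>\<close> steps and do not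
  fit into a window.
\<close>

section \<open>The cycle and its cyclic windows\<close>

locale long_cycle =
  fixes n :: nat
  assumes n_ge_3: "n \<ge> 3"
begin

sublocale graph "with_proj (cycle_graph n)"
  by (rule graph_cycle_graph) (rule n_ge_3)

lemma n_pos: "n > 0"
  using n_ge_3 by simp

lemma verts_cycle [simp]: "pverts (cycle_graph n) = {0..<n}"
  by (simp add: cycle_graph_def)

lemma arc_cycle_iff:
  "(i, j) \<in> parcs (cycle_graph n) \<longleftrightarrow> i < n \<and> j < n \<and> (j = Suc i mod n \<or> i = Suc j mod n)"
  by (simp add: cycle_graph_def)

text \<open>The start \<open>a\<close> may be any natural number and is reduced only inside the
  image, so windows can be shifted or unrolled past \<open>n\<close>. The parameter \<open>l\<close>
  counts edges, hence \<open>l + 1\<close> offsets.\<close>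

definition window :: "nat \<Rightarrow> nat \<Rightarrow> nat set" where
  "window a l = (\<lambda>i. (a + i) mod n) ` {..l}"

lemma window_mod: "window (a mod n) l = window a l"
  by (simp add: window_def mod_simps)

lemma window_mono: "l \<le> l' \<Longrightarrow> window a l \<subseteq> window a l'"
  by (auto simp: window_def)

lemma window_Suc: "window a (Suc l) = insert (a mod n) (window (Suc a) l)"
  by (simp add: window_def atMost_Suc_eq_insert_0 image_image)

lemma finite_window [simp]: "finite (window a l)"
  by (simp add: window_def)

section \<open>Walks in the cycle\<close>

lemma walk_cost: "awalk_cost (\<lambda>_. 1) p = real (length p)"
  by (induct p) (auto simp: awalk_cost_def)

text \<open>Each arc prepends a neighbour of the current start, which costs at most one more place
  on the left or the right. Only inclusion holds, since a walk may turn back.\<close>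

lemma awalk_window:
  "awalk u p v \<Longrightarrow> \<exists>a. set (awalk_verts u p) \<subseteq> window a (length p)"
proof (induct p arbitrary: u)
  case Nil
  then have "set (awalk_verts u []) \<subseteq> window u 0"
    by (auto simp: awalk_Nil_iff window_def)
  then show ?case by auto
next
  case (Cons e p)
  obtain i j where e: "e = (i, j)" by (cases e)
  from Cons.prems have u: "u = i" and arc: "(i, j) \<in> parcs (cycle_graph n)" and w: "awalk j p v"
    by (auto simp: awalk_Cons_iff e)
  from Cons.hyps[OF w] obtain a where a: "set (awalk_verts j p) \<subseteq> window a (length p)" by blast
  with hd_in_awalk_verts(1)[OF w] obtain t where t: "t \<le> length p" "j = (a + t) mod n"
    by (auto simp: window_def)
  from arc consider "j = Suc i mod n" | "i = Suc j mod n"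
    by (auto simp: arc_cycle_iff)
  then show ?case
  proof cases
    case 1
    \<comment> \<open>The window grows to the left: \<open>b\<close> plays \<open>a - 1\<close>
      modulo \<open>n\<close>, without truncated subtraction.\<close>
    define b where "b = a + (n - 1)"
    have sb: "Suc b = a + n" using n_pos by (simp add: b_def)
    have wb: "window (Suc b) l = window a l" for l
      unfolding sb by (metis window_mod mod_add_self2)
    have "Suc i mod n = Suc (b + t) mod n"
      using 1 t(2) sb by (metis add.commute add.left_commute add_Suc_right mod_add_self1)
    then have "(Suc i + (n - 1)) mod n = (Suc (b + t) + (n - 1)) mod n"
      by (metis mod_add_left_eq)
    then have "i mod n = (b + t) mod n"
      using n_pos by simp
    then have "i = (b + t) mod n" using arc by (simp add: arc_cycle_iff)
    then have "i \<in> window b (Suc (length p))"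
      using t(1) by (auto simp: window_def)
    moreover have "window a (length p) \<subseteq> window b (Suc (length p))"
      using window_Suc[of b "length p"] wb by auto
    ultimately show ?thesis using a by (auto simp: e)
  next
    case 2
    then have "i = (a + Suc t) mod n"
      using t(2) by (simp add: mod_simps)
    then have "i \<in> window a (Suc (length p))"
      using t(1) unfolding window_def by blast
    with a window_mono[of "length p" "Suc (length p)" a] show ?thesis
      by (auto simp: e)
  qed
qed

text \<open>Lifts the walk to the integers: \<open>s\<close> is the number of forward minus backward
  steps. This later bounds from below the length of any walk joining the ends of a window.\<close>

lemma awalk_displacement:
  "awalk u p v \<Longrightarrow> \<exists>s::int. \<bar>s\<bar> \<le> int (length p) \<and> int v = (int u + s) mod int n"
proof (induct p arbitrary: u)
  case Nil
  then show ?case by (intro exI[of _ 0]) (auto simp: awalk_Nil_iff)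
next
  case (Cons e p)
  obtain i j where e: "e = (i, j)" by (cases e)
  from Cons.prems have u: "u = i" and arc: "(i, j) \<in> parcs (cycle_graph n)" and w: "awalk j p v"
    by (auto simp: awalk_Cons_iff e)
  from Cons.hyps[OF w] obtain s where s: "\<bar>s\<bar> \<le> int (length p)" "int v = (int j + s) mod int n"
    by blast
  from arc consider "j = Suc i mod n" | "i = Suc j mod n"
    by (auto simp: arc_cycle_iff)
  then show ?case
  proof cases
    case 1
    then have "int v = (int i + (s + 1)) mod int n"
      using s(2) by (simp add: zmod_int mod_simps algebra_simps)
    with s(1) u show ?thesis by (intro exI[of _ "s + 1"]) auto
  next
    case 2
    have "(int i + (s - 1)) mod int n = (int (Suc j) + (s - 1)) mod int n"
      unfolding 2 zmod_int by (rule mod_add_left_eq)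
    also have "int (Suc j) + (s - 1) = int j + s" by simp
    finally have "(int j + s) mod int n = (int i + (s - 1)) mod int n" by simp
    with s u show ?thesis by (intro exI[of _ "s - 1"]) auto
  qed
qed

lemma forward_awalk:
  "\<exists>p. awalk (a mod n) p ((a + l) mod n) \<and> length p = l \<and>
       awalk_verts (a mod n) p = map (\<lambda>i. (a + i) mod n) [0..<Suc l]"
proof (induct l arbitrary: a)
  case 0
  then show ?case using n_pos by (intro exI[of _ "[]"]) (auto simp: awalk_Nil_iff)
next
  case (Suc l)
  from Suc[of "Suc a"] obtain p where p: "awalk (Suc a mod n) p ((Suc a + l) mod n)" "length p = l"
    "awalk_verts (Suc a mod n) p = map (\<lambda>i. (Suc a + i) mod n) [0..<Suc l]"
    by blast
  have "(a mod n, Suc a mod n) \<in> parcs (cycle_graph n)"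
    using n_pos by (auto simp: arc_cycle_iff mod_simps)
  with p have "awalk (a mod n) ((a mod n, Suc a mod n) # p) ((a + Suc l) mod n)"
    by (simp add: awalk_Cons_iff)
  moreover have "awalk_verts (a mod n) ((a mod n, Suc a mod n) # p)
      = map (\<lambda>i. (a + i) mod n) [0..<Suc (Suc l)]"
    by (subst upt_conv_Cons, simp, subst map_Suc_upt[symmetric]) (simp add: p(3) del: upt_Suc)
  ultimately show ?case using p(2)
    by (intro exI[of _ "(a mod n, Suc a mod n) # p"]) simp
qed

lemma backward_awalk:
  "\<exists>p. awalk ((a + l) mod n) p (a mod n) \<and> length p = l"
proof (induct l)
  case 0
  then show ?case using n_pos by (intro exI[of _ "[]"]) (auto simp: awalk_Nil_iff)
next
  case (Suc l)
  then obtain p where p: "awalk ((a + l) mod n) p (a mod n)" "length p = l" by blast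
  have "((a + Suc l) mod n, (a + l) mod n) \<in> parcs (cycle_graph n)"
    using n_pos by (auto simp: arc_cycle_iff mod_simps)
  with p show ?case
    by (intro exI[of _ "((a + Suc l) mod n, (a + l) mod n) # p"]) (simp add: awalk_Cons_iff)
qed

lemma short_awalk:
  assumes "u < n" "v < n"
  shows "\<exists>p. awalk u p v \<and> length p \<le> n div 2"
proof -
  \<comment> \<open>\<open>s\<close> and \<open>t\<close> are the forward distances from
    \<open>u\<close> to \<open>v\<close> and from \<open>v\<close> to \<open>u\<close>. Their sum is
    at most \<open>n\<close>, so one of the two ways round is short.\<close>
  define s where "s = (v + n - u) mod n"
  define t where "t = (u + n - v) mod n"
  have v: "v = (u + s) mod n" and u: "u = (v + t) mod n"
    using assms by (simp_all add: s_def t_def mod_simps)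
  have "s \<le> n div 2 \<or> t \<le> n div 2"
  proof (cases "u \<le> v")
    case True
    then have "v + n - u = (v - u) + n" by linarith
    then have "s = (v - u) mod n" unfolding s_def by (metis mod_add_self2)
    then have "s = v - u" using assms by simp
    moreover have "t \<le> u + n - v" unfolding t_def by (rule mod_less_eq_dividend)
    ultimately show ?thesis using assms True by linarith
  next
    case False
    then have "u + n - v = (u - v) + n" by linarith
    then have "t = (u - v) mod n" unfolding t_def by (metis mod_add_self2)
    then have "t = u - v" using assms by simp
    moreover have "s \<le> v + n - u" unfolding s_def by (rule mod_less_eq_dividend)
    ultimately show ?thesis using assms False by linarith
  qed
  then show ?thesis
  proof
    assume "s \<le> n div 2"
    with forward_awalk[of u s] v assms show ?thesis by auto
  next
    assume "t \<le> n div 2"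
    with backward_awalk[of v t] u assms show ?thesis by auto
  qed
qed

section \<open>Shortest paths and windows\<close>

lemma shortest_path_length:
  assumes "shortest_path u p v"
  shows "length p \<le> n div 2"
proof -
  from assms have ap: "awalk u p v" and eq: "ereal (real (length p)) = \<mu> (\<lambda>_. 1) u v"
    by (auto simp: shortest_path_def graph_dist_def apath_def)
  from ap have "u < n" "v < n"
    using awalk_hd_in_verts[OF ap] awalk_last_in_verts[OF ap] by auto
  then obtain q where q: "awalk u q v" "length q \<le> n div 2" using short_awalk by blast
  from min_cost_le_walk_cost[OF q(1), of "\<lambda>_. 1"] have "length p \<le> length q"
    unfolding eq[symmetric] walk_cost by simp
  with q(2) show ?thesis by simp
qed

lemma inj_on_window:
  assumes "l < n"
  shows "inj_on (\<lambda>i. (a + i) mod n) {..l}"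
proof -
  have "i = j" if "i \<le> l" "j \<le> l" "(a + i) mod n = (a + j) mod n" "i \<le> j" for i j
  proof -
    from that(3) have "n dvd j - i"
      using mod_eq_dvd_iff_nat[of "a + i" "a + j" n] that(4) by simp
    with that assms show "i = j" by (auto dest: dvd_imp_le)
  qed
  then show ?thesis
    by (intro inj_onI) (metis atMost_iff nat_le_linear)
qed

text \<open>Every window reaching at most half-way round is realised by a shortest path, so
  independence constrains all of them.\<close>

lemma window_shortest_path:
  assumes "l \<le> n div 2"
  shows "\<exists>u p v. shortest_path u p v \<and> length p = l \<and> set (awalk_verts u p) = window a l"
proof -
  from forward_awalk[of a l] obtain p where p: "awalk (a mod n) p ((a + l) mod n)" "length p = l"
    "awalk_verts (a mod n) p = map (\<lambda>i. (a + i) mod n) [0..<Suc l]" by blast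
  have ln: "l < n" using assms n_ge_3 by linarith
  have "distinct (awalk_verts (a mod n) p)"
    using inj_on_window[OF ln] unfolding p(3)
    by (simp add: distinct_map atLeast0LessThan lessThan_Suc_atMost del: upt_Suc)
  then have ap: "apath (a mod n) p ((a + l) mod n)" using p(1) by (simp add: apath_def)
  \<comment> \<open>A shorter walk would have a displacement \<open>s\<close> congruent to
    \<open>l\<close> with absolute value below \<open>l\<close>; then \<open>l - s\<close> is a
    positive multiple of \<open>n\<close> smaller than \<open>2 * l \<le> n\<close>.\<close>
  have min: "l \<le> length q" if q: "awalk (a mod n) q ((a + l) mod n)" for q
  proof (rule ccontr)
    assume less: "\<not> l \<le> length q"
    from awalk_displacement[OF q] obtain s :: int where s: "\<bar>s\<bar> \<le> int (length q)"
      "int ((a + l) mod n) = (int (a mod n) + s) mod int n" by blast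
    from s(2) have "(int a + int l) mod int n = (int a + s) mod int n"
      by (simp add: zmod_int mod_simps)
    then have "int n dvd int l - s" by (simp add: mod_eq_dvd_iff)
    moreover have "int l - s > 0" using s(1) less by linarith
    ultimately have "int n \<le> int l - s" by (rule zdvd_imp_le)
    then show False using s(1) less assms by linarith
  qed
  have "\<mu> (\<lambda>_. 1) (a mod n) ((a + l) mod n) = ereal (real l)"
  proof (rule antisym)
    show "\<mu> (\<lambda>_. 1) (a mod n) ((a + l) mod n) \<le> ereal (real l)"
      using min_cost_le_walk_cost[OF p(1), of "\<lambda>_. 1"] p(2) by (simp add: walk_cost)
    show "ereal (real l) \<le> \<mu> (\<lambda>_. 1) (a mod n) ((a + l) mod n)"
      unfolding \<mu>_def using min by (intro INF_greatest) (simp add: walk_cost)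
  qed
  then have "shortest_path (a mod n) p ((a + l) mod n)"
    using ap p(2) by (simp add: shortest_path_def graph_dist_def)
  moreover have "set (awalk_verts (a mod n) p) = window a l"
    unfolding p(3) window_def
    by (simp add: atLeast0LessThan lessThan_Suc_atMost del: upt_Suc)
  ultimately show ?thesis using p(2) by blast
qed

text \<open>Only the maximal window length matters, because shorter paths lie inside longer windows.
  Paths do not appear after this point.\<close>

lemma kd_independent_iff:
  "kd_independent k d S \<longleftrightarrow>
     S \<subseteq> {0..<n} \<and> (\<forall>a. card (S \<inter> window a (min d (n div 2))) < k)"
proof (intro iffI conjI allI)
  assume ind: "kd_independent k d S"
  then show "S \<subseteq> {0..<n}" by (simp add: kd_independent_def)
  fix a
  from window_shortest_path[of "min d (n div 2)" a] obtain u p v where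
    "shortest_path u p v" "length p = min d (n div 2)"
    "set (awalk_verts u p) = window a (min d (n div 2))" by auto
  with ind show "card (S \<inter> window a (min d (n div 2))) < k"
    unfolding kd_independent_def by (metis min.cobounded1)
next
  assume *: "S \<subseteq> {0..<n} \<and> (\<forall>a. card (S \<inter> window a (min d (n div 2))) < k)"
  have "card (S \<inter> set (awalk_verts u p)) < k"
    if sp: "shortest_path u p v" and "length p \<le> d" for u p v
  proof -
    from sp have "awalk u p v" by (simp add: shortest_path_def apath_def)
    from awalk_window[OF this] obtain a where "set (awalk_verts u p) \<subseteq> window a (length p)" by blast
    also have "\<dots> \<subseteq> window a (min d (n div 2))"
      using shortest_path_length[OF sp] that(2) by (intro window_mono) simp
    finally have "card (S \<inter> set (awalk_verts u p)) \<le> card (S \<inter> window a (min d (n div 2)))"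
      by (intro card_mono) auto
    with * show ?thesis by (meson le_less_trans)
  qed
  with * show "kd_independent k d S" unfolding kd_independent_def by auto
qed

lemma kd_independent_short:
  assumes "S \<subseteq> {0..<n}" "d + 1 < k"
  shows "kd_independent k d S"
  unfolding kd_independent_iff
proof (intro conjI allI assms(1))
  fix a
  have "card (S \<inter> window a (min d (n div 2))) \<le> card (window a (min d (n div 2)))"
    by (intro card_mono) auto
  also have "\<dots> \<le> card {..min d (n div 2)}"
    unfolding window_def by (intro card_image_le) auto
  finally show "card (S \<inter> window a (min d (n div 2))) < k" using assms(2) by simp
qed

section \<open>Double counting and the lower bound\<close>

lemma bij_rotation: "bij_betw (\<lambda>a. (a + i) mod n) {0..<n} {0..<n}"
proof -
  \<comment> \<open>Start and offset exchange roles: this is the full window starting at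
    \<open>i\<close>.\<close>
  have inj: "inj_on (\<lambda>a. (i + a) mod n) {..n - 1}"
    by (rule inj_on_window) (use n_pos in simp)
  have eq: "{..n - 1} = {0..<n}" using n_pos by auto
  have inj': "inj_on (\<lambda>a. (a + i) mod n) {0..<n}"
    using inj unfolding eq by (simp add: add.commute)
  have "(\<lambda>a. (a + i) mod n) ` {0..<n} \<subseteq> {0..<n}" using n_pos by auto
  from endo_inj_surj[OF finite_atLeastLessThan this inj'] inj' show ?thesis
    by (simp add: bij_betw_def)
qed

text \<open>For each fixed offset the starts run through every vertex once, so each vertex is
  counted once per offset. The bound \<open>l < n\<close> keeps offsets within a window
  distinct.\<close>

lemma sum_card_windows:
  assumes "S \<subseteq> {0..<n}" "l < n"
  shows "(\<Sum>a<n. card (S \<inter> window a l)) = card S * (l + 1)"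
proof -
  have 1: "card (S \<inter> window a l) = (\<Sum>i\<le>l. if (a + i) mod n \<in> S then 1 else 0)" for a
  proof -
    have "card (S \<inter> window a l) = card ((\<lambda>i. (a + i) mod n) ` {i \<in> {..l}. (a + i) mod n \<in> S})"
      by (rule arg_cong[where f = card]) (auto simp: window_def)
    also have "\<dots> = card {i \<in> {..l}. (a + i) mod n \<in> S}"
      by (rule card_image) (rule inj_on_subset[OF inj_on_window[OF assms(2)]], auto)
    finally show ?thesis by (simp add: sum.If_cases Int_def)
  qed
  have 2: "(\<Sum>a<n. if (a + i) mod n \<in> S then 1 else 0) = card S" for i
  proof -
    have "(\<Sum>a<n. if (a + i) mod n \<in> S then 1 else (0::nat)) = (\<Sum>v\<in>{0..<n}. if v \<in> S then 1 else 0)"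
      unfolding lessThan_atLeast0
      by (rule sum.reindex_bij_betw[OF bij_rotation, where g = "\<lambda>v. if v \<in> S then 1 else 0"])
    also have "\<dots> = card S"
      using assms(1) by (simp add: sum.If_cases Int_absorb1)
    finally show ?thesis .
  qed
  show ?thesis unfolding 1 by (subst sum.swap) (simp add: 2)
qed

lemma kd_independent_card:
  assumes "kd_independent k d S"
  shows "card S \<le> ((k - 1) * n) div (min d (n div 2) + 1)"
proof -
  let ?l = "min d (n div 2)"
  have "card S * (?l + 1) = (\<Sum>a<n. card (S \<inter> window a ?l))"
    using assms n_ge_3 by (subst sum_card_windows) (auto simp: kd_independent_iff)
  also have "\<dots> \<le> (\<Sum>a<n. k - 1)"
  proof (rule sum_mono)
    fix a
    from assms have "card (S \<inter> window a ?l) < k" by (simp add: kd_independent_iff)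
    then show "card (S \<inter> window a ?l) \<le> k - 1" by simp
  qed
  finally show ?thesis by (simp add: less_eq_div_iff_mult_less_eq mult.commute)
qed

lemma kd_coloring_lower_bound:
  assumes "kd_proper_coloring k d c f"
  shows "n \<le> c * (((k - 1) * n) div (min d (n div 2) + 1))"
proof -
  have "{0..<n} = (\<Union>i\<in>{1..c}. {v \<in> {0..<n}. f v = i})"
    using assms by (auto simp: kd_proper_coloring_def)
  then have "n = card (\<Union>i\<in>{1..c}. {v \<in> {0..<n}. f v = i})"
    by (metis card_atLeastLessThan minus_nat.diff_0)
  also have "\<dots> \<le> (\<Sum>i\<in>{1..c}. card {v \<in> {0..<n}. f v = i})"
    by (rule card_UN_le) simp
  also have "\<dots> \<le> (\<Sum>i\<in>{1..c}. ((k - 1) * n) div (min d (n div 2) + 1))"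
    using assms by (intro sum_mono kd_independent_card) (auto simp: kd_proper_coloring_def)
  finally show ?thesis by simp
qed

section \<open>The block coloring and the upper bound\<close>

lemma class_kd_independent:
  assumes k: "k \<ge> 2" and m: "m > 0" "m * (min d (n div 2) + 1) \<le> (k - 1) * n"
  shows "kd_independent k d {v \<in> {0..<n}. (v * m mod n) div m = j}"
  unfolding kd_independent_iff
proof (intro conjI allI)
  fix a
  define l where "l = min d (n div 2)"
  \<comment> \<open>The window is unrolled to an interval of naturals, so that \<open>q x\<close>,
    the index of the length-\<open>n\<close> block containing \<open>x * m\<close>, does not wrap
    around.\<close>
  define X where "X = {x \<in> {a..a + l}. (x * m mod n) div m = j}"
  define q where "q = (\<lambda>x. x * m div n)"
  have bounds: "j * m + q x * n \<le> x * m" "x * m < j * m + m + q x * n" if "x \<in> X" for x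
  proof -
    have "x * m mod n = j * m + x * m mod n mod m"
      using that by (metis (mono_tags, lifting) X_def div_mult_mod_eq mem_Collect_eq)
    moreover have "x * m mod n mod m < m" using m(1) by simp
    moreover have "x * m = q x * n + x * m mod n" by (simp add: q_def)
    ultimately show "j * m + q x * n \<le> x * m" "x * m < j * m + m + q x * n" by linarith+
  qed
  \<comment> \<open>Within one block the color confines \<open>x * m\<close> to a half-open interval
    of length \<open>m\<close>, which holds only one multiple of \<open>m\<close>.\<close>
  have inj: "inj_on q X"
  proof -
    have "x = y" if "x \<in> X" "y \<in> X" "q x = q y" "x \<le> y" for x y
    proof (rule ccontr)
      assume "x \<noteq> y"
      then have "Suc x * m \<le> y * m" using that(4) by (intro mult_le_mono1) simp
      then show False using bounds[OF that(1)] bounds[OF that(2)] that(3) by simp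
    qed
    then show ?thesis by (intro inj_onI) (metis nat_le_linear)
  qed
  \<comment> \<open>Along the window \<open>x * m\<close> grows by at most \<open>l * m\<close>, and
    the width of the color interval adds less than \<open>m\<close>. By \<open>m(2)\<close> the sum
    stays below \<open>k - 1\<close> blocks.\<close>
  have spread: "q y < q x + (k - 1)" if "x \<in> X" "y \<in> X" for x y
  proof -
    have "y \<le> x + l" using that by (auto simp: X_def)
    then have "y * m \<le> (x + l) * m" by (rule mult_le_mono1)
    then have "q y * n < q x * n + m * (l + 1)"
      using bounds[OF that(1)] bounds[OF that(2)] by (simp add: algebra_simps)
    also have "\<dots> \<le> (q x + (k - 1)) * n"
      using m(2) by (simp add: l_def algebra_simps)
    finally show ?thesis by simp
  qed
  \<comment> \<open>The color of \<open>x\<close> depends only on \<open>x mod n\<close>, so class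
    members in the window lift to \<open>X\<close>.\<close>
  have "{v \<in> {0..<n}. (v * m mod n) div m = j} \<inter> window a l \<subseteq> (\<lambda>x. x mod n) ` X"
  proof
    fix v assume v: "v \<in> {v \<in> {0..<n}. (v * m mod n) div m = j} \<inter> window a l"
    then obtain i where i: "i \<le> l" "v = (a + i) mod n" by (auto simp: window_def)
    have "v * m mod n = (a + i) * m mod n" unfolding i(2) by (simp only: mod_mult_left_eq)
    with v i have "a + i \<in> X" by (simp add: X_def)
    with i(2) show "v \<in> (\<lambda>x. x mod n) ` X" by blast
  qed
  then have "card ({v \<in> {0..<n}. (v * m mod n) div m = j} \<inter> window a l) \<le> card X"
    using surj_card_le[of X] by (simp add: X_def)
  also have "\<dots> < k"
  proof (cases "X = {}")
    case True
    with k show ?thesis by simp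
  next
    case False
    have finX: "finite (q ` X)" by (simp add: X_def)
    have "Min (q ` X) \<in> q ` X" using finX False by (intro Min_in) auto
    then obtain x where x: "x \<in> X" "q x = Min (q ` X)" by auto
    have "q ` X \<subseteq> {q x..<q x + (k - 1)}"
      using spread[OF x(1)] finX by (auto simp: x(2))
    then have "card (q ` X) \<le> k - 1"
      using card_mono[of "{q x..<q x + (k - 1)}" "q ` X"] by simp
    with inj k show ?thesis by (simp add: card_image)
  qed
  finally show "card ({v \<in> {0..<n}. (v * m mod n) div m = j} \<inter> window a (min d (n div 2))) < k"
    by (simp add: l_def)
qed auto

text \<open>The \<open>c\<close> intervals of length \<open>m\<close> cover all residues modulo
  \<open>n\<close>; \<open>Suc\<close> moves their indices from 0-based to colors starting at
  1.\<close>

lemma kd_coloring_exists: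
  assumes "k \<ge> 2" and "m > 0" "m * (min d (n div 2) + 1) \<le> (k - 1) * n" and "n \<le> c * m"
  shows "kd_proper_coloring k d c (\<lambda>v. Suc ((v * m mod n) div m))"
  unfolding kd_proper_coloring_def
proof (intro conjI ballI)
  have "(v * m mod n) div m < c" for v
  proof -
    have "v * m mod n < c * m" using n_pos assms(4) by (meson mod_less_divisor less_le_trans)
    then show ?thesis by (simp add: less_mult_imp_div_less)
  qed
  then show "(\<lambda>v. Suc ((v * m mod n) div m)) \<in> verts (with_proj (cycle_graph n)) \<rightarrow> {1..c}"
    by (auto simp: Suc_le_eq)
next
  fix i assume "i \<in> {1..c}"
  then obtain j where "i = Suc j" by (cases i) auto
  with class_kd_independent[OF assms(1-3), of j]
  show "kd_independent k d {v \<in> verts (with_proj (cycle_graph n)). Suc (v * m mod n div m) = i}"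
    by simp
qed

section \<open>The value of the chromatic number\<close>

lemma kd_chromatic_number_short:
  assumes "d + 1 < k"
  shows "kd_chromatic_number k d = 1"
  unfolding kd_chromatic_number_def
proof (rule Least_equality)
  have "kd_proper_coloring k d 1 (\<lambda>_. 1)"
    unfolding kd_proper_coloring_def using assms by (auto intro: kd_independent_short)
  then show "0 < (1::nat) \<and> (\<exists>f. kd_proper_coloring k d 1 f)" by auto
qed auto

lemma kd_chromatic_number_cycle:
  assumes "k \<ge> 2" and m: "m = ((k - 1) * n) div (min d (n div 2) + 1)"
  shows "int (kd_chromatic_number k d) = \<lceil>real n / real m\<rceil>"
proof -
  \<comment> \<open>Positivity of \<open>m\<close> is needed so that \<open>real n / real m\<close>
    is a genuine quotient, not the default 0.\<close>
  have "min d (n div 2) + 1 \<le> 1 * n" using n_ge_3 by linarith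
  also have "1 * n \<le> (k - 1) * n" using assms(1) by (intro mult_le_mono1) linarith
  finally have mpos: "m > 0" unfolding m by (subst div_greater_zero_iff) simp
  have mle: "m * (min d (n div 2) + 1) \<le> (k - 1) * n" unfolding m by (rule div_times_less_eq_dividend)
  define c where "c = nat \<lceil>real n / real m\<rceil>"
  have "real n / real m > 0" using mpos n_pos by simp
  then have cpos: "c > 0" and c: "int c = \<lceil>real n / real m\<rceil>" by (auto simp: c_def)
  \<comment> \<open>Used twice: at \<open>c' = c\<close> it makes the coloring available, and for an
    arbitrary proper coloring it gives minimality.\<close>
  have c_le: "c \<le> c' \<longleftrightarrow> n \<le> c' * m" for c'
  proof -
    have "c \<le> c' \<longleftrightarrow> real n / real m \<le> real c'"
      using c by (metis ceiling_le_iff of_int_of_nat_eq of_nat_le_iff)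
    also have "\<dots> \<longleftrightarrow> n \<le> c' * m"
      using mpos by (simp add: pos_divide_le_eq flip: of_nat_mult)
    finally show ?thesis .
  qed
  have "kd_chromatic_number k d = c"
    unfolding kd_chromatic_number_def
  proof (rule Least_equality)
    show "0 < c \<and> (\<exists>f. kd_proper_coloring k d c f)"
      using kd_coloring_exists[OF assms(1) mpos mle] c_le cpos by blast
  next
    fix c' assume "0 < c' \<and> (\<exists>f. kd_proper_coloring k d c' f)"
    then show "c \<le> c'" using kd_coloring_lower_bound c_le m by blast
  qed
  with c show ?thesis by simp
qed

end

theorem theorem5p7:
  fixes d k n \<delta> m :: nat
  assumes "d \<ge> 1" and "k \<ge> 2" and "n \<ge> 3"
    and "\<delta> = min d (nat \<lfloor>real n / 2\<rfloor>)"
    and "m = nat \<lfloor>real ((k - 1) * n) / real (\<delta> + 1)\<rfloor>"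
  shows "(1 \<le> d \<and> d \<le> k - 2 \<longrightarrow>
            graph.kd_chromatic_number (with_proj (cycle_graph n)) k d = 1) \<and>
         (d \<ge> k - 1 \<longrightarrow>
            int (graph.kd_chromatic_number (with_proj (cycle_graph n)) k d) = \<lceil>real n / real m\<rceil>)"
proof -
  interpret long_cycle n by unfold_locales (rule assms(3))
  have "nat \<lfloor>real n / 2\<rfloor> = n div 2"
    using floor_divide_of_nat_eq[of n 2, where 'a = real] by simp
  then have "\<delta> = min d (n div 2)" using assms(4) by simp
  moreover have "m = ((k - 1) * n) div (\<delta> + 1)"
    unfolding assms(5) by (simp only: floor_divide_of_nat_eq nat_int)
  ultimately have "m = ((k - 1) * n) div (min d (n div 2) + 1)" by simp
  \<comment> \<open>Since \<open>k \<ge> 2\<close>, the subtraction \<open>k - 2\<close> is exact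
    and \<open>d \<le> k - 2\<close> means \<open>d + 1 < k\<close>.\<close>
  from kd_chromatic_number_cycle[OF assms(2) this] kd_chromatic_number_short[of d k]
  show ?thesis using assms(1,2) by auto
qed

end
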